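(* If $K\subset\mathbb{R}^2$ is a planar convex body, then $\Lambda(K)\ge \frac12$, and equality holds if and only if $K$ is a triangle.
   Context: A convex body in $\mathbb{R}^n$ is a compact convex set with nonempty interior. A frame is an orthonormal basis $F=\{u_1,\ldots,u_n\}$ of $\mathbb{R}^n$. $K|u^\perp$ denotes the orthogonal projection of $K$ onto the hyperplane $u^\perp$ through the origin perpendicular to $u$. The LW-constant of $K$ is $$\Lambda(K)=\max_F \frac{\mathrm{vol}_n(K)^{n-1}}{\prod_{i=1}^n \mathrm{vol}_{n-1}(K|u_i^\perp)},$$ the maximum being over all frames $F=\{u_1,\ldots,u_n\}$ of $\mathbb{R}^n$ (it is attained). Here $n=2$. *)

theory Defs
  imports "HOL-Analysis.Analysis"
begin

definition convex_body :: "'a::euclidean_space set \<Rightarrow> bool" where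
  "convex_body K \<longleftrightarrow> compact K \<and> convex K \<and> interior K \<noteq> {}"

definition orthonormal_basis :: "'a::euclidean_space set \<Rightarrow> 'a set \<Rightarrow> bool" where
  "orthonormal_basis S B \<longleftrightarrow> pairwise orthogonal B \<and> (\<forall>b\<in>B. norm b = 1) \<and> span B = S"

definition frame :: "'a::euclidean_space set \<Rightarrow> bool" where
  "frame F \<longleftrightarrow> orthonormal_basis UNIV F"

abbreviation perp :: "'a::euclidean_space \<Rightarrow> 'a set" where
  "perp u \<equiv> orthogonal_comp {u}"

definition orth_proj :: "'a::euclidean_space set \<Rightarrow> 'a set \<Rightarrow> 'a set" where
  "orth_proj S K = {y \<in> S. \<exists>x\<in>K. x - y \<in> orthogonal_comp S}"

text \<open>
  Lebesgue measure on a linear subspace \<open>S\<close>, in its own dimension: the product measure carried over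
  from the coordinates with respect to an orthonormal basis of \<open>S\<close>. This is how \<^const>\<open>lborel\<close> is
  built, with \<^const>\<open>Basis\<close> replaced by that basis; by rotation invariance the choice of the basis
  is immaterial.
\<close>
definition subspace_lborel :: "'a::euclidean_space set \<Rightarrow> 'a measure" where
  "subspace_lborel S =
     (let B = (SOME B. orthonormal_basis S B)
      in distr (\<Pi>\<^sub>M b\<in>B. lborel) borel (\<lambda>f. \<Sum>b\<in>B. f b *\<^sub>R b))"

definition LW_ratio :: "'a::euclidean_space set \<Rightarrow> 'a set \<Rightarrow> real" where
  "LW_ratio K F =
     measure lebesgue K ^ (DIM('a) - 1) /
     (\<Prod>u\<in>F. measure (subspace_lborel (perp u)) (orth_proj (perp u) K))"

text \<open>
  A genuine maximum over the infinite set of frames: \<^const>\<open>Max\<close> would be meaningless here, and a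
  supremum need not be attained.
\<close>
definition LW_constant :: "'a::euclidean_space set \<Rightarrow> real" where
  "LW_constant K = (GREATEST r. \<exists>F. frame F \<and> r = LW_ratio K F)"

end

(* In the plane the ratio of a frame {u, v} is area(K) / (w(u) w(v)), where w is the width of K, so
   the claim is about the smallest circumscribed rectangle. Take u along a diameter ab of K, of
   length d, and let c, e be points of K furthest from the line ab on either side. Then w(u) = d, and
   the triangles abc and abe in K have total area w(u) w(v) / 2, whence the bound. Equality
   for this rectangle forces K to be the union of the two triangles; if neither degenerates, a small
   rotation of (u, v), in the direction that does not increase the width across ab to first
   order, gives a strictly smaller rectangle. Conversely no rectangle around a triangle has less
   than twice its area. *)
theory Submission
  imports Defs
begin

section \<open>Width of a compact set in a direction\<close>

text \<open>The direction is an arbitrary vector rather than a unit vector. Width is then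
  homogeneous in \<open>u\<close>, so that unnormalised directions such as u + t v can be measured
  first and rescaled afterwards.\<close>

definition width :: "'a::euclidean_space set \<Rightarrow> 'a \<Rightarrow> real" where
  "width K u = Sup ((\<lambda>x. x \<bullet> u) ` K) - Inf ((\<lambda>x. x \<bullet> u) ` K)"

lemma width_minus: "width K (- u) = width K u"
proof -
  have "(\<lambda>x. x \<bullet> (- u)) ` K = uminus ` (\<lambda>x. x \<bullet> u) ` K"
    by (auto simp: image_image)
  then show ?thesis
    by (simp add: width_def Inf_real_def image_image)
qed

lemma width_attained:
  fixes K :: "'a::euclidean_space set"
  assumes "compact K" "K \<noteq> {}"
  obtains p q where "p \<in> K" "q \<in> K" "width K u = (p - q) \<bullet> u"
    "\<And>x. x \<in> K \<Longrightarrow> x \<bullet> u \<le> p \<bullet> u" "\<And>x. x \<in> K \<Longrightarrow> q \<bullet> u \<le> x \<bullet> u"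
proof -
  have cont: "continuous_on K (\<lambda>x. x \<bullet> u)" by (intro continuous_intros)
  obtain p where p: "p \<in> K" "\<And>x. x \<in> K \<Longrightarrow> x \<bullet> u \<le> p \<bullet> u"
    using continuous_attains_sup[OF assms cont] by blast
  obtain q where q: "q \<in> K" "\<And>x. x \<in> K \<Longrightarrow> q \<bullet> u \<le> x \<bullet> u"
    using continuous_attains_inf[OF assms cont] by blast
  have "Sup ((\<lambda>x. x \<bullet> u) ` K) = p \<bullet> u"
    using p by (intro cSup_eq_maximum) auto
  moreover have "Inf ((\<lambda>x. x \<bullet> u) ` K) = q \<bullet> u"
    using q by (intro cInf_eq_minimum) auto
  ultimately show ?thesis
    using that p q by (simp add: width_def inner_diff_left)
qed

lemma width_ge:
  assumes "compact K" "p \<in> K" "q \<in> K"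
  shows "(p - q) \<bullet> u \<le> width K u"
proof -
  have "K \<noteq> {}" using assms by auto
  from width_attained[OF assms(1) this, of u] obtain a b where
    "width K u = (a - b) \<bullet> u"
    "\<And>x. x \<in> K \<Longrightarrow> x \<bullet> u \<le> a \<bullet> u" "\<And>x. x \<in> K \<Longrightarrow> b \<bullet> u \<le> x \<bullet> u" by metis
  from this(1) this(2)[OF assms(2)] this(3)[OF assms(3)]
  show ?thesis by (simp add: inner_diff_left)
qed

lemma width_le:
  assumes "compact K" "K \<noteq> {}" "\<And>x. x \<in> K \<Longrightarrow> l \<le> x \<bullet> u" "\<And>x. x \<in> K \<Longrightarrow> x \<bullet> u \<le> r"
  shows "width K u \<le> r - l"
proof -
  obtain p q where "p \<in> K" "q \<in> K" "width K u = (p - q) \<bullet> u"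
    using width_attained[OF assms(1,2), of u] by metis
  with assms(3)[of q] assms(4)[of p] show ?thesis by (simp add: inner_diff_left)
qed

lemma width_scaleR:
  assumes "compact K" "K \<noteq> {}" "c \<ge> 0"
  shows "width K (c *\<^sub>R u) = c * width K u"
proof (rule antisym)
  obtain p q where "p \<in> K" "q \<in> K" "width K (c *\<^sub>R u) = (p - q) \<bullet> (c *\<^sub>R u)"
    using width_attained[OF assms(1,2), of "c *\<^sub>R u"] by metis
  then show "width K (c *\<^sub>R u) \<le> c * width K u"
    using width_ge[OF assms(1), of p q u] assms(3) by (simp add: mult_left_mono)
  obtain p q where "p \<in> K" "q \<in> K" "width K u = (p - q) \<bullet> u"
    using width_attained[OF assms(1,2), of u] by metis
  then show "c * width K u \<le> width K (c *\<^sub>R u)"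
    using width_ge[OF assms(1), of p q "c *\<^sub>R u"] by simp
qed

lemma width_pos:
  assumes "convex_body K" "u \<noteq> 0"
  shows "width K u > 0"
proof -
  obtain x e where e: "e > 0" "cball x e \<subseteq> K"
    using assms(1) unfolding convex_body_def by (meson ex_in_conv mem_interior_cball)
  have "x \<in> K" "x + (e / norm u) *\<^sub>R u \<in> K"
    using e assms(2) by (auto simp: dist_norm intro!: subsetD[OF e(2)])
  then have "((x + (e / norm u) *\<^sub>R u) - x) \<bullet> u \<le> width K u"
    using assms(1) by (intro width_ge) (auto simp: convex_body_def)
  moreover have "((x + (e / norm u) *\<^sub>R u) - x) \<bullet> u > 0"
    using e assms(2) by simp
  ultimately show ?thesis by linarith
qed

text \<open>A pair of points realising the width along \<open>u\<close> is a competitor for the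
  width along \<open>w\<close>. The two widths therefore differ by at most (p - q) applied to u - w,
  which makes the diameter of K a Lipschitz constant.\<close>

lemma continuous_on_width:
  assumes "compact K" "K \<noteq> {}"
  shows "continuous_on A (width K)"
proof -
  have 1: "width K u - width K w \<le> diameter K * dist u w" for u w
  proof -
    obtain p q where pq: "p \<in> K" "q \<in> K" "width K u = (p - q) \<bullet> u"
      using width_attained[OF assms, of u] by metis
    have "width K u - width K w \<le> (p - q) \<bullet> (u - w)"
      using width_ge[OF assms(1) pq(1,2), of w] pq(3) by (simp add: inner_diff_right)
    also have "\<dots> \<le> norm (p - q) * norm (u - w)" by (rule norm_cauchy_schwarz)
    also have "\<dots> \<le> diameter K * norm (u - w)"
      using diameter_bounded_bound[OF compact_imp_bounded[OF assms(1)] pq(1,2)]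
      by (intro mult_right_mono) (auto simp: dist_norm)
    finally show ?thesis by (simp add: dist_norm)
  qed
  have "(diameter K)-lipschitz_on A (width K)"
  proof (rule lipschitz_onI)
    show "dist (width K u) (width K w) \<le> diameter K * dist u w" for u w
      using 1[of u w] 1[of w u] by (auto simp: dist_real_def dist_commute abs_le_iff)
  qed (use assms(1) in \<open>simp add: diameter_ge_0 compact_imp_bounded\<close>)
  then show ?thesis by (rule lipschitz_on_continuous_on)
qed

section \<open>Orthonormal pairs and frames of the plane\<close>

lemma orthonormal_pair_span:
  fixes u v :: "real^2"
  assumes "norm u = 1" "norm v = 1" "u \<bullet> v = 0"
  shows "u \<noteq> v" "span {u, v} = UNIV" "pairwise orthogonal {u, v}"
proof -
  show ne: "u \<noteq> v" using assms by (metis norm_zero inner_eq_zero_iff zero_neq_one)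
  show orth: "pairwise orthogonal {u, v}"
    using assms by (auto simp: pairwise_def orthogonal_def inner_commute)
  have "independent {u, v}"
    using orth assms by (intro pairwise_orthogonal_independent) auto
  then have "UNIV \<subseteq> span {u, v}"
    using ne by (intro card_ge_dim_independent) auto
  then show "span {u, v} = UNIV" by auto
qed

lemma orthonormal_pair_expand:
  fixes u v :: "real^2"
  assumes "norm u = 1" "norm v = 1" "u \<bullet> v = 0"
  shows "x = (x \<bullet> u) *\<^sub>R u + (x \<bullet> v) *\<^sub>R v"
proof -
  note s = orthonormal_pair_span[OF assms]
  have "(\<Sum>i\<in>{u, v}. (x \<bullet> i) *\<^sub>R i) = x"
    using s assms by (intro orthonormal_basis_expand) auto
  then show ?thesis using s(1) by simp
qed

lemma orthonormal_pair_inner: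
  fixes u v :: "real^2"
  assumes "norm u = 1" "norm v = 1" "u \<bullet> v = 0"
  shows "x \<bullet> y = (x \<bullet> u) * (y \<bullet> u) + (x \<bullet> v) * (y \<bullet> v)"
proof -
  have "x \<bullet> y = x \<bullet> ((y \<bullet> u) *\<^sub>R u + (y \<bullet> v) *\<^sub>R v)"
    using orthonormal_pair_expand[OF assms, of y] by simp
  then show ?thesis by (simp add: inner_add_right mult.commute)
qed

lemma frame_plane_iff:
  fixes F :: "(real^2) set"
  shows "frame F \<longleftrightarrow> (\<exists>u v. F = {u, v} \<and> norm u = 1 \<and> norm v = 1 \<and> u \<bullet> v = 0)"
proof
  assume F: "frame F"
  then have o: "pairwise orthogonal F" "\<And>b. b \<in> F \<Longrightarrow> norm b = 1" "span F = UNIV"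
    by (auto simp: frame_def orthonormal_basis_def)
  have "independent F"
    using o(1,2) by (intro pairwise_orthogonal_independent) force+
  then have "card F = dim (span F)"
    by (simp add: dim_eq_card_independent)
  then have "card F = 2" by (simp add: o(3))
  then obtain u v where "F = {u, v}" "u \<noteq> v" by (auto simp: card_2_iff)
  then show "\<exists>u v. F = {u, v} \<and> norm u = 1 \<and> norm v = 1 \<and> u \<bullet> v = 0"
    using o(1,2) by (auto simp: pairwise_def orthogonal_def)
next
  assume "\<exists>u v. F = {u, v} \<and> norm u = 1 \<and> norm v = 1 \<and> u \<bullet> v = 0"
  then show "frame F"
    using orthonormal_pair_span by (auto simp: frame_def orthonormal_basis_def)
qed

lemma exists_orthonormal_partner:
  fixes u :: "real^2"
  assumes "norm u = 1"
  obtains v where "norm v = 1" "u \<bullet> v = 0"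
proof
  define v :: "real^2" where "v = vector [- (u $ 2), u $ 1]"
  show "u \<bullet> v = 0" by (simp add: v_def inner_vec_def sum_2)
  show "norm v = 1" using assms by (simp add: v_def norm_vec_def L2_set_def sum_2 add.commute)
qed

section \<open>Projections onto lines and the LW-ratio\<close>

lemma perp_eq_line:
  fixes u v :: "real^2"
  assumes "norm u = 1" "norm v = 1" "u \<bullet> v = 0"
  shows "perp u = range (\<lambda>t. t *\<^sub>R v)"
proof -
  have "y = (y \<bullet> v) *\<^sub>R v" if "u \<bullet> y = 0" for y
    using orthonormal_pair_expand[OF assms, of y] that by (simp add: inner_commute)
  then show ?thesis
    using assms by (auto simp: orthogonal_comp_def orthogonal_def)
qed

text \<open>\<open>subspace_lborel\<close> picks a basis of the line by \<open>SOME\<close>. With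
  both candidates listed, the measure can be computed whichever of them is picked.\<close>

lemma orthonormal_basis_perp:
  fixes u v :: "real^2"
  assumes "norm u = 1" "norm v = 1" "u \<bullet> v = 0"
  shows "orthonormal_basis (perp u) B \<longleftrightarrow> B = {v} \<or> B = {- v}"
proof
  assume B: "orthonormal_basis (perp u) B"
  have "b = v \<or> b = - v" if "b \<in> B" for b
  proof -
    have "b \<in> perp u" "norm b = 1"
      using B that span_base by (auto simp: orthonormal_basis_def)
    then obtain t where "b = t *\<^sub>R v"
      unfolding perp_eq_line[OF assms] by blast
    moreover have "\<bar>t\<bar> = 1"
      using \<open>norm b = 1\<close> assms(2) calculation by simp
    ultimately
    show ?thesis by (auto simp: abs_if split: if_splits)
  qed
  moreover have "B \<noteq> {}"
  proof
    assume "B = {}"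
    then have "perp u = {0}" using B by (simp add: orthonormal_basis_def)
    moreover have "1 *\<^sub>R v \<in> perp u" unfolding perp_eq_line[OF assms] by blast
    ultimately show False using assms by auto
  qed
  moreover have "\<not> (v \<in> B \<and> - v \<in> B)"
  proof
    assume "v \<in> B \<and> - v \<in> B"
    moreover have vv: "v \<bullet> v = 1" using assms by (simp add: dot_square_norm)
    moreover have "v \<noteq> - v"
    proof
      assume "v = - v"
      from arg_cong[OF this, of "\<lambda>x. x \<bullet> v"] vv show False by simp
    qed
    moreover have "\<not> orthogonal v (- v)" using vv by (simp add: orthogonal_def)
    ultimately show False using B by (auto simp: orthonormal_basis_def pairwise_def)
  qed
  ultimately show "B = {v} \<or> B = {- v}" by blast
next
  have "orthonormal_basis (perp u) {w}" if "w = v \<or> w = - v" for w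
  proof -
    have w: "norm w = 1" "u \<bullet> w = 0" using that assms by auto
    then show ?thesis
      using perp_eq_line[OF assms(1) w] by (simp add: orthonormal_basis_def span_singleton)
  qed
  then show "B = {v} \<or> B = {- v} \<Longrightarrow> orthonormal_basis (perp u) B" by auto
qed

lemma orth_proj_perp:
  fixes u v :: "real^2"
  assumes "norm u = 1" "norm v = 1" "u \<bullet> v = 0"
  shows "orth_proj (perp u) K = (\<lambda>x. (x \<bullet> v) *\<^sub>R v) ` K"
proof -
  have "v \<bullet> v = 1" using assms by (simp add: dot_square_norm)
  then have "x - s *\<^sub>R v \<in> orthogonal_comp (perp u) \<longleftrightarrow> s = x \<bullet> v" for x s
    unfolding perp_eq_line[OF assms]
    by (auto simp: orthogonal_comp_def orthogonal_def inner_diff_right inner_commute)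
  then show ?thesis
    unfolding orth_proj_def perp_eq_line[OF assms] by auto
qed

text \<open>The projection is the segment of all t w with t in the interval of values of x on w over
  K. Its preimage under the coordinate map of the basis {w} is a one-dimensional box over that
  interval, whose measure is the width along w. The undetermined sign of w is absorbed by
  \<open>width_minus\<close>.\<close>

lemma measure_orth_proj_perp:
  fixes u v :: "real^2"
  assumes uv: "norm u = 1" "norm v = 1" "u \<bullet> v = 0"
    and K: "compact K" "convex K" "K \<noteq> {}"
  shows "measure (subspace_lborel (perp u)) (orth_proj (perp u) K) = width K v"
proof -
  define B where "B = (SOME B. orthonormal_basis (perp u) B)"
  have "orthonormal_basis (perp u) B"
    unfolding B_def by (rule someI[of _ "{v}"]) (simp add: orthonormal_basis_perp[OF uv])
  then obtain w where w: "B = {w}" "w = v \<or> w = - v"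
    by (auto simp: orthonormal_basis_perp[OF uv])
  have uw: "norm u = 1" "norm w = 1" "u \<bullet> w = 0" using uv w(2) by auto
  let ?I = "(\<lambda>x. x \<bullet> w) ` K"
  have "compact ?I"
    by (intro compact_continuous_image continuous_intros K(1))
  moreover have "connected ?I"
    by (intro connected_continuous_image continuous_intros convex_connected K(2))
  ultimately have "\<exists>l r. ?I = {l..r}"
    by (simp flip: connected_compact_interval_1)
  then obtain l r where I: "?I = {l..r}"
    by (elim exE)
  then have lr: "l \<le> r" using K(3) by (metis atLeastatMost_empty_iff image_is_empty)
  then have wd: "width K w = r - l" unfolding width_def I by simp
  interpret product_sigma_finite "\<lambda>_::real^2. lborel :: real measure"
    by (simp add: product_sigma_finite_def lborel.sigma_finite_measure_axioms)
  let ?P = "\<Pi>\<^sub>M b\<in>{w}. (lborel :: real measure)"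
  have proj: "orth_proj (perp u) K = (\<lambda>t. t *\<^sub>R w) ` {l..r}"
    by (simp add: orth_proj_perp[OF uw] I[symmetric] image_image)
  have meas: "(\<lambda>f. \<Sum>b\<in>{w}. f b *\<^sub>R b) \<in> ?P \<rightarrow>\<^sub>M borel"
    by measurable
  have "compact (orth_proj (perp u) K)"
    unfolding proj by (intro compact_continuous_image continuous_intros) auto
  then have borel: "orth_proj (perp u) K \<in> sets borel"
    by (intro borel_closed compact_imp_closed)
  \<comment> \<open>Since w is a unit vector, t w determines t, so the preimage is the box and
    nothing more.\<close>
  have pre: "(\<lambda>f. \<Sum>b\<in>{w}. f b *\<^sub>R b) -` orth_proj (perp u) K \<inter> space ?P = (\<Pi>\<^sub>E b\<in>{w}. {l..r})"
    using uw(2) unfolding proj space_PiM by (auto simp: PiE_iff)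
  have "emeasure ?P (\<Pi>\<^sub>E b\<in>{w}. {l..r}) = ennreal (r - l)"
    using lr by (subst emeasure_PiM) auto
  then have "measure ?P (\<Pi>\<^sub>E b\<in>{w}. {l..r}) = r - l"
    using lr by (simp add: measure_def)
  moreover have "measure (subspace_lborel (perp u)) (orth_proj (perp u) K)
      = measure ?P (\<Pi>\<^sub>E b\<in>{w}. {l..r})"
    unfolding subspace_lborel_def Let_def B_def[symmetric] w(1)
    by (subst measure_distr[OF meas borel]) (simp only: pre)
  ultimately show ?thesis using wd w(2) width_minus[of K v] by auto
qed

text \<open>Projecting along \<open>u\<close> measures the width along \<open>v\<close> and
  conversely, so the two factors come out swapped. Since u and v are distinct, the product over the
  set {u, v} really has two factors.\<close>

lemma LW_ratio_plane:
  fixes K :: "(real^2) set"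
  assumes K: "convex_body K" and uv: "norm u = 1" "norm v = 1" "u \<bullet> v = 0"
  shows "LW_ratio K {u, v} = measure lebesgue K / (width K u * width K v)"
proof -
  have K': "compact K" "convex K" "K \<noteq> {}"
    using K by (auto simp: convex_body_def)
  have vu: "v \<bullet> u = 0" using uv by (simp add: inner_commute)
  show ?thesis
    unfolding LW_ratio_def
    using measure_orth_proj_perp[OF uv K'] measure_orth_proj_perp[OF uv(2,1) vu K']
      orthonormal_pair_span(1)[OF uv]
    by (simp add: mult.commute)
qed

text \<open>\<open>GREATEST\<close> carries information only once a greatest value is known to
  exist. Orthonormal pairs form a compact set, and the quotient is continuous on it because the
  widths of a convex body in nonzero directions are positive.\<close>

lemma LW_constant_attained:
  fixes K :: "(real^2) set"
  assumes K: "convex_body K"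
  obtains u v where "norm u = 1" "norm v = 1" "u \<bullet> v = 0"
    "LW_constant K = measure lebesgue K / (width K u * width K v)"
    "\<And>u' v'. norm u' = 1 \<Longrightarrow> norm v' = 1 \<Longrightarrow> u' \<bullet> v' = 0 \<Longrightarrow>
       measure lebesgue K / (width K u' * width K v') \<le> LW_constant K"
proof -
  let ?P = "{p :: (real^2) \<times> (real^2). norm (fst p) = 1 \<and> norm (snd p) = 1 \<and> fst p \<bullet> snd p = 0}"
  let ?g = "\<lambda>p. measure lebesgue K / (width K (fst p) * width K (snd p))"
  have K': "compact K" "K \<noteq> {}" using K by (auto simp: convex_body_def)
  have "closed ?P"
    by (intro closed_Collect_conj closed_Collect_eq continuous_intros)
  moreover have "bounded ?P"
    by (rule bounded_subset[OF bounded_Times[OF bounded_cball[of 0 1] bounded_cball[of 0 1]]]) auto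
  ultimately have "compact ?P" by (simp add: compact_eq_bounded_closed)
  moreover have "?P \<noteq> {}"
  proof -
    have n: "norm (axis 1 1 :: real^2) = 1" by (simp add: norm_axis_1)
    from exists_orthonormal_partner[OF this] obtain v :: "real^2"
      where "norm v = 1" "axis 1 1 \<bullet> v = 0" .
    with n have "(axis 1 1, v) \<in> ?P" by simp
    then show ?thesis by blast
  qed
  moreover have "continuous_on ?P ?g"
  proof (intro continuous_intros ballI)
    show "continuous_on ?P (\<lambda>p. width K (fst p))" "continuous_on ?P (\<lambda>p. width K (snd p))"
      by (rule continuous_on_compose2[OF continuous_on_width[OF K', of UNIV]], auto intro: continuous_intros)+
    show "width K (fst p) * width K (snd p) \<noteq> 0" if "p \<in> ?P" for p
      using that width_pos[OF K, of "fst p"] width_pos[OF K, of "snd p"] by force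
  qed
  ultimately obtain p where p: "p \<in> ?P" "\<And>q. q \<in> ?P \<Longrightarrow> ?g q \<le> ?g p"
    using continuous_attains_sup[of ?P ?g] by blast
  have "LW_constant K = ?g p"
    unfolding LW_constant_def
  proof (rule Greatest_equality)
    show "\<exists>F. frame F \<and> ?g p = LW_ratio K F"
      using p(1) LW_ratio_plane[OF K, of "fst p" "snd p"]
      by (intro exI[of _ "{fst p, snd p}"]) (auto simp: frame_plane_iff)
    show "y \<le> ?g p" if "\<exists>F. frame F \<and> y = LW_ratio K F" for y
      using that p(2) LW_ratio_plane[OF K] by (fastforce simp: frame_plane_iff)
  qed
  then show ?thesis
    using p that[of "fst p" "snd p"] by force
qed

section \<open>Area of a triangle against its circumscribed rectangles\<close>

text \<open>The square of the determinant of two edge vectors is their Gram determinant, which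
  involves inner products only. It has the same form in every orthonormal basis, so the area formula
  passes from standard coordinates to those of u and v.\<close>

lemma measure_triangle:
  fixes a b c u v :: "real^2"
  assumes uv: "norm u = 1" "norm v = 1" "u \<bullet> v = 0"
  shows "measure lebesgue (convex hull {a, b, c}) =
    \<bar>((b - a) \<bullet> u) * ((c - a) \<bullet> v) - ((c - a) \<bullet> u) * ((b - a) \<bullet> v)\<bar> / 2"
proof -
  define p q where "p = b - a" and "q = c - a"
  have "compact (convex hull {a, b, c})" by (simp add: compact_convex_hull)
  then have "measure lebesgue (convex hull {a, b, c}) = measure lborel (convex hull {a, b, c})"
    by (intro measure_completion) (simp add: borel_compact)
  also have "\<dots> = \<bar>q $ 1 * p $ 2 - p $ 1 * q $ 2\<bar> / 2"
    unfolding content_triangle p_def q_def by simp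
  finally have 1: "measure lebesgue (convex hull {a, b, c}) = \<bar>q $ 1 * p $ 2 - p $ 1 * q $ 2\<bar> / 2" .
  have "(q $ 1 * p $ 2 - p $ 1 * q $ 2)\<^sup>2 = (p \<bullet> p) * (q \<bullet> q) - (p \<bullet> q)\<^sup>2"
    by (simp add: inner_vec_def sum_2 power2_eq_square algebra_simps)
  also have "\<dots> = ((p \<bullet> u) * (q \<bullet> v) - (q \<bullet> u) * (p \<bullet> v))\<^sup>2"
    unfolding orthonormal_pair_inner[OF uv, of p p] orthonormal_pair_inner[OF uv, of q q]
      orthonormal_pair_inner[OF uv, of p q]
    by (simp add: power2_eq_square algebra_simps)
  finally have "\<bar>q $ 1 * p $ 2 - p $ 1 * q $ 2\<bar> = \<bar>(p \<bullet> u) * (q \<bullet> v) - (q \<bullet> u) * (p \<bullet> v)\<bar>"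
    by (simp add: power2_eq_iff abs_eq_iff)
  then show ?thesis using 1 by (simp add: p_def q_def)
qed

text \<open>With the abscissae sorted, the determinant is a combination of two differences of
  ordinates with the nonnegative coefficients x2 - x1 and x3 - x2, whose sum is at most W.\<close>

lemma abs_det_le_sorted:
  fixes x1 x2 x3 y1 y2 y3 W H :: real
  assumes "x1 \<le> x2" "x2 \<le> x3" "x3 - x1 \<le> W" "\<bar>y1 - y2\<bar> \<le> H" "\<bar>y2 - y3\<bar> \<le> H"
  shows "\<bar>(x2 - x1) * (y3 - y1) - (x3 - x1) * (y2 - y1)\<bar> \<le> W * H"
proof -
  have "\<bar>(x2 - x1) * (y3 - y1) - (x3 - x1) * (y2 - y1)\<bar> = \<bar>(x2 - x1) * (y3 - y2) + (x3 - x2) * (y1 - y2)\<bar>"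
    by (simp add: algebra_simps)
  also have "\<dots> \<le> (x2 - x1) * \<bar>y3 - y2\<bar> + (x3 - x2) * \<bar>y1 - y2\<bar>"
    using assms by (intro order_trans[OF abs_triangle_ineq]) (simp add: abs_mult)
  also have "\<dots> \<le> (x2 - x1) * H + (x3 - x2) * H"
    using assms by (intro add_mono mult_left_mono) (auto simp: abs_minus_commute)
  also have "\<dots> = (x3 - x1) * H" by (simp add: algebra_simps)
  also have "\<dots> \<le> W * H" using assms by (intro mult_right_mono) auto
  finally show ?thesis .
qed

text \<open>Permuting the three points changes the determinant at most in sign, so each of the six
  orders of the abscissae reduces to the sorted one.\<close>

lemma abs_det_le:
  fixes x1 x2 x3 y1 y2 y3 W H :: real
  assumes x: "\<bar>x1 - x2\<bar> \<le> W" "\<bar>x2 - x3\<bar> \<le> W" "\<bar>x1 - x3\<bar> \<le> W"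
    and y: "\<bar>y1 - y2\<bar> \<le> H" "\<bar>y2 - y3\<bar> \<le> H" "\<bar>y1 - y3\<bar> \<le> H"
  shows "\<bar>(x2 - x1) * (y3 - y1) - (x3 - x1) * (y2 - y1)\<bar> \<le> W * H" (is "\<bar>?D\<bar> \<le> _")
proof -
  have D: "(x3 - x1) * (y2 - y1) - (x2 - x1) * (y3 - y1) = - ?D"
    "(x1 - x2) * (y3 - y2) - (x3 - x2) * (y1 - y2) = - ?D"
    "(x3 - x2) * (y1 - y2) - (x1 - x2) * (y3 - y2) = ?D"
    "(x1 - x3) * (y2 - y3) - (x2 - x3) * (y1 - y3) = ?D"
    "(x2 - x3) * (y1 - y3) - (x1 - x3) * (y2 - y3) = - ?D"
    by (simp_all add: algebra_simps)
  consider "x1 \<le> x2" "x2 \<le> x3" | "x1 \<le> x3" "x3 \<le> x2" | "x2 \<le> x1" "x1 \<le> x3"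
    | "x2 \<le> x3" "x3 \<le> x1" | "x3 \<le> x1" "x1 \<le> x2" | "x3 \<le> x2" "x2 \<le> x1"
    by linarith
  then show ?thesis
  proof cases
    case 1
    have "\<bar>(x2 - x1) * (y3 - y1) - (x3 - x1) * (y2 - y1)\<bar> \<le> W * H"
      using 1 x y by (intro abs_det_le_sorted) (auto simp: abs_minus_commute abs_le_iff)
    then show ?thesis by simp
  next
    case 2
    have "\<bar>(x3 - x1) * (y2 - y1) - (x2 - x1) * (y3 - y1)\<bar> \<le> W * H"
      using 2 x y by (intro abs_det_le_sorted) (auto simp: abs_minus_commute abs_le_iff)
    then show ?thesis by (simp only: D abs_minus_cancel)
  next
    case 3
    have "\<bar>(x1 - x2) * (y3 - y2) - (x3 - x2) * (y1 - y2)\<bar> \<le> W * H"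
      using 3 x y by (intro abs_det_le_sorted) (auto simp: abs_minus_commute abs_le_iff)
    then show ?thesis by (simp only: D abs_minus_cancel)
  next
    case 4
    have "\<bar>(x3 - x2) * (y1 - y2) - (x1 - x2) * (y3 - y2)\<bar> \<le> W * H"
      using 4 x y by (intro abs_det_le_sorted) (auto simp: abs_minus_commute abs_le_iff)
    then show ?thesis by (simp only: D abs_minus_cancel)
  next
    case 5
    have "\<bar>(x1 - x3) * (y2 - y3) - (x2 - x3) * (y1 - y3)\<bar> \<le> W * H"
      using 5 x y by (intro abs_det_le_sorted) (auto simp: abs_minus_commute abs_le_iff)
    then show ?thesis by (simp only: D abs_minus_cancel)
  next
    case 6
    have "\<bar>(x2 - x3) * (y1 - y3) - (x1 - x3) * (y2 - y3)\<bar> \<le> W * H"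
      using 6 x y by (intro abs_det_le_sorted) (auto simp: abs_minus_commute abs_le_iff)
    then show ?thesis by (simp only: D abs_minus_cancel)
  qed
qed

text \<open>Twice the area is the modulus of a determinant in the coordinates of the vertices, and
  these coordinates differ by at most the two widths.\<close>

lemma triangle_width_product_ge:
  fixes a b c u v :: "real^2"
  assumes uv: "norm u = 1" "norm v = 1" "u \<bullet> v = 0"
  defines "T \<equiv> convex hull {a, b, c}"
  shows "2 * measure lebesgue T \<le> width T u * width T v"
proof -
  have T: "compact T" by (simp add: T_def compact_convex_hull)
  have abc: "a \<in> T" "b \<in> T" "c \<in> T" by (simp_all add: T_def hull_inc)
  have w: "\<bar>p \<bullet> w - q \<bullet> w\<bar> \<le> width T w" if "p \<in> T" "q \<in> T" for p q w
    using width_ge[OF T that, of w] width_ge[OF T that(2,1), of w]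
    by (simp add: inner_diff_left)
  have "\<bar>(b \<bullet> u - a \<bullet> u) * (c \<bullet> v - a \<bullet> v) - (c \<bullet> u - a \<bullet> u) * (b \<bullet> v - a \<bullet> v)\<bar>
      \<le> width T u * width T v"
    by (intro abs_det_le w abc)
  then show ?thesis
    using measure_triangle[OF uv, of a b c] by (simp add: T_def inner_diff_left)
qed

section \<open>Convex bodies and triangles in the equality case\<close>

text \<open>A point of K outside Q is a limit of interior points of K. Hence the open set of
  interior points outside Q is nonempty and has positive measure, which K cannot afford if Q has at
  least its measure.\<close>

lemma convex_body_eqI_measure:
  fixes K Q :: "'a::euclidean_space set"
  assumes K: "convex_body K" and Q: "closed Q" "Q \<subseteq> K"
    and le: "measure lebesgue K \<le> measure lebesgue Q"
  shows "Q = K"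
proof (rule ccontr)
  assume "Q \<noteq> K"
  then obtain x where x: "x \<in> K" "x \<notin> Q" using Q by auto
  have K': "compact K" "convex K" "interior K \<noteq> {}" using K by (auto simp: convex_body_def)
  have "x \<in> closure (interior K)"
    using convex_closure_interior[OF K'(2,3)] x(1) closure_subset by blast
  moreover have "open (- Q)" "x \<in> - Q" using Q x by auto
  ultimately have ne: "interior K \<inter> - Q \<noteq> {}"
    using open_Int_closure_eq_empty[of "- Q" "interior K"] by blast
  have Kl: "K \<in> lmeasurable" using K'(1) by (rule lmeasurable_compact)
  have "compact Q" using K'(1) Q by (metis closed_subset compact_Int_closed inf.absorb_iff2)
  then have Ql: "Q \<in> lmeasurable" by (rule lmeasurable_compact)
  then have "measure lebesgue (K - Q) = measure lebesgue K - measure lebesgue Q"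
    using Kl Q by (intro measurable_measure_Diff) (auto simp: fmeasurableD)
  then have "measure lebesgue (K - Q) = 0" using le measure_nonneg[of lebesgue "K - Q"] by linarith
  then have "negligible (K - Q)"
    using Kl Ql negligible_iff_measure fmeasurable.Diff by blast
  then have "negligible (interior K \<inter> - Q)"
    by (rule negligible_subset) (use interior_subset in auto)
  moreover have "open (interior K \<inter> - Q)" using Q by auto
  ultimately show False using ne open_not_negligible by blast
qed

text \<open>Nonempty interior forces affine dimension 2, and three points span that only if they are
  distinct and affinely independent.\<close>

lemma triangle_simplex:
  fixes K :: "(real^2) set"
  assumes "convex_body K" "K = convex hull {a, b, c}"
  shows "2 simplex K"
proof -
  have "aff_dim K = 2"
    using assms(1) by (subst aff_dim_nonempty_interior) (auto simp: convex_body_def)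
  then have d: "aff_dim {a, b, c} = 2" using assms(2) by (simp add: aff_dim_convex_hull)
  have "aff_dim {a, b, c} \<le> int (card {a, b, c}) - 1"
    by (intro aff_dim_le_card) auto
  moreover have "card {a, b, c} \<le> 3" by (simp add: card_insert_if)
  ultimately have "card {a, b, c} = 3" using d by linarith
  moreover have "\<not> affine_dependent {a, b, c}"
    using d calculation by (simp add: affine_independent_iff_card)
  ultimately show ?thesis
    unfolding simplex_def assms(2) by (intro exI[of _ "{a, b, c}"]) auto
qed

section \<open>Rotating a circumscribed rectangle\<close>

text \<open>The vectors u + t v and v - t u are orthogonal and both have length sqrt (1 + t^2).
  Normalising them divides the product of the widths by 1 + t^2, and this factor is what makes a
  rotated rectangle strictly smaller.\<close>

lemma rotated_width_product:
  fixes u v :: "real^2"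
  assumes K: "compact K" "K \<noteq> {}" and uv: "norm u = 1" "norm v = 1" "u \<bullet> v = 0"
  obtains u' v' where "norm u' = 1" "norm v' = 1" "u' \<bullet> v' = 0"
    "width K u' * width K v' = width K (u + t *\<^sub>R v) * width K (v - t *\<^sub>R u) / (1 + t\<^sup>2)"
proof -
  define s where "s = sqrt (1 + t\<^sup>2)"
  have s: "s > 0" "s\<^sup>2 = 1 + t\<^sup>2" unfolding s_def by (auto simp: add_pos_nonneg)
  have in1: "u \<bullet> u = 1" "v \<bullet> v = 1" "v \<bullet> u = 0"
    using uv by (auto simp: dot_square_norm inner_commute)
  define u' v' where "u' = (1 / s) *\<^sub>R (u + t *\<^sub>R v)" and "v' = (1 / s) *\<^sub>R (v - t *\<^sub>R u)"
  have "norm (u + t *\<^sub>R v) = s" "norm (v - t *\<^sub>R u) = s"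
    using in1 uv(3) by (simp_all add: norm_eq_sqrt_inner s_def inner_add inner_diff power2_eq_square add.commute)
  then have "norm u' = 1" "norm v' = 1" using s by (auto simp: u'_def v'_def)
  moreover have "u' \<bullet> v' = 0"
    using in1 uv(3) by (simp add: u'_def v'_def inner_add_left inner_add_right inner_diff_left inner_diff_right)
  moreover have "width K u' * width K v' = width K (u + t *\<^sub>R v) * width K (v - t *\<^sub>R u) / (1 + t\<^sup>2)"
    using s by (simp add: u'_def v'_def width_scaleR[OF K] power2_eq_square[of s] flip: s(2))
  ultimately show ?thesis by (rule that)
qed

text \<open>With origin a and axes u, v the points are a = (0, 0), b = (d, 0), c = (p, h) and e =
  (q, -g). For small t the points a, b stay extremal along u + t v and c, e along v - t u, so the
  two widths are at most d and h + g - t (p - q).\<close>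

lemma narrower_rotated_rectangle:
  fixes a b c e u v :: "real^2"
  assumes K: "compact K" "K \<noteq> {}" "K \<subseteq> convex hull {a, b, c} \<union> convex hull {a, b, e}"
    and uv: "norm u = 1" "norm v = 1" "u \<bullet> v = 0"
    and ab: "b - a = d *\<^sub>R u"
    and c: "0 < (c - a) \<bullet> u" "(c - a) \<bullet> u < d" "0 < (c - a) \<bullet> v"
    and e: "0 < (e - a) \<bullet> u" "(e - a) \<bullet> u < d" "(e - a) \<bullet> v < 0"
  obtains u' v' where "norm u' = 1" "norm v' = 1" "u' \<bullet> v' = 0"
    "width K u' * width K v' < d * ((c - e) \<bullet> v)"
proof -
  define p h q g where "p = (c - a) \<bullet> u" and "h = (c - a) \<bullet> v"
    and "q = (e - a) \<bullet> u" and "g = - ((e - a) \<bullet> v)"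
  have pos: "0 < p" "p < d" "0 < h" "0 < q" "q < d" "0 < g"
    using c e by (auto simp: p_def h_def q_def g_def)
  \<comment> \<open>The smallest slack in the conditions that keep a, b, c, e extremal, and a
    rotation small enough that t times any of the lengths involved stays within it.\<close>
  define m where "m = Min {p, d - p, q, d - q, h, g}"
  have m: "0 < m" "m \<le> p" "m \<le> d - p" "m \<le> q" "m \<le> d - q" "m \<le> h" "m \<le> g"
    using pos by (auto simp: m_def)
  define \<epsilon> where "\<epsilon> = m / (h + g + d)"
  have \<epsilon>: "\<epsilon> > 0" "\<epsilon> * (h + g + d) = m" using m pos by (auto simp: \<epsilon>_def)
  \<comment> \<open>The sign is chosen so that the first-order change -t (p - q) of the second width
    is not positive.\<close>
  define t where "t = (if q \<le> p then \<epsilon> else - \<epsilon>)"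
  have t: "t \<noteq> 0" "\<bar>t\<bar> = \<epsilon>" "t * (p - q) \<ge> 0"
    using \<epsilon>(1) by (auto simp: t_def mult_nonneg_nonpos)
  have small: "\<bar>t * x\<bar> \<le> m" if "0 \<le> x" "x \<le> h + g + d" for x
    using that \<epsilon> t(2) mult_left_mono[OF that(2), of \<epsilon>] by (simp add: abs_mult)
  have tb: "\<bar>t * h\<bar> \<le> m" "\<bar>t * g\<bar> \<le> m" "\<bar>t * p\<bar> \<le> m" "\<bar>t * q\<bar> \<le> m"
    "\<bar>t * (d - p)\<bar> \<le> m" "\<bar>t * (d - q)\<bar> \<le> m"
    using pos by (intro small; linarith)+
  have in1: "u \<bullet> u = 1" "v \<bullet> v = 1" "v \<bullet> u = 0"
    using uv by (auto simp: dot_square_norm inner_commute)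
  \<comment> \<open>A slab is convex, so bounds for a linear functional on K need checking only at
    the four vertices.\<close>
  have bound: "l \<le> x \<bullet> w \<and> x \<bullet> w \<le> r"
    if "x \<in> K" "\<And>y. y \<in> {a, b, c, e} \<Longrightarrow> l \<le> y \<bullet> w \<and> y \<bullet> w \<le> r" for x w l r
  proof -
    have "convex ({y. w \<bullet> y \<ge> l} \<inter> {y. w \<bullet> y \<le> r})"
      by (intro convex_Int convex_halfspace_le convex_halfspace_ge)
    then have "convex hull {a, b, c} \<union> convex hull {a, b, e} \<subseteq> {y. w \<bullet> y \<ge> l} \<inter> {y. w \<bullet> y \<le> r}"
      using that(2) by (intro Un_least hull_minimal) (auto simp: inner_commute)
    with that(1) K(3) have "x \<in> {y. w \<bullet> y \<ge> l} \<inter> {y. w \<bullet> y \<le> r}" by blast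
    then show ?thesis by (simp add: inner_commute)
  qed
  have coords: "b \<bullet> u = a \<bullet> u + d" "b \<bullet> v = a \<bullet> v" "c \<bullet> u = a \<bullet> u + p" "c \<bullet> v = a \<bullet> v + h"
    "e \<bullet> u = a \<bullet> u + q" "e \<bullet> v = a \<bullet> v - g"
    using arg_cong[OF ab, of "\<lambda>x. x \<bullet> u"] arg_cong[OF ab, of "\<lambda>x. x \<bullet> v"] in1 uv(3)
    by (simp_all add: p_def h_def q_def g_def inner_diff_left)
  let ?u = "u + t *\<^sub>R v" and ?v = "v - t *\<^sub>R u"
  have wu: "width K ?u \<le> d"
  proof -
    have "a \<bullet> ?u \<le> x \<bullet> ?u \<and> x \<bullet> ?u \<le> a \<bullet> ?u + d" if "x \<in> K" for x
    proof (rule bound[OF that])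
      show "a \<bullet> ?u \<le> y \<bullet> ?u \<and> y \<bullet> ?u \<le> a \<bullet> ?u + d" if "y \<in> {a, b, c, e}" for y
        using that tb m pos by (auto simp: inner_add_right coords algebra_simps abs_le_iff)
    qed
    then show ?thesis
      using width_le[OF K(1,2), of "a \<bullet> ?u" ?u "a \<bullet> ?u + d"] by auto
  qed
  have wv: "width K ?v \<le> h + g - t * (p - q)"
  proof -
    have "e \<bullet> ?v \<le> x \<bullet> ?v \<and> x \<bullet> ?v \<le> c \<bullet> ?v" if "x \<in> K" for x
    proof (rule bound[OF that])
      show "e \<bullet> ?v \<le> y \<bullet> ?v \<and> y \<bullet> ?v \<le> c \<bullet> ?v" if "y \<in> {a, b, c, e}" for y
        using that tb m pos by (auto simp: inner_diff_right coords algebra_simps abs_le_iff)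
    qed
    then have "width K ?v \<le> c \<bullet> ?v - e \<bullet> ?v"
      using width_le[OF K(1,2), of "e \<bullet> ?v" ?v "c \<bullet> ?v"] by auto
    then show ?thesis by (simp add: inner_diff_right coords algebra_simps)
  qed
  obtain x where "x \<in> K" using K(2) by auto
  then have nonneg: "0 \<le> width K w" for w using width_ge[OF K(1), of x x w] by simp
  obtain u' v' where uv': "norm u' = 1" "norm v' = 1" "u' \<bullet> v' = 0"
    "width K u' * width K v' = width K ?u * width K ?v / (1 + t\<^sup>2)"
    using rotated_width_product[OF K(1,2) uv] by metis
  \<comment> \<open>Before normalisation the product need not shrink at all, for instance when p =
    q. The strict decrease comes from the division by 1 + t^2 with t nonzero.\<close>
  have "width K ?u * width K ?v \<le> d * (h + g)"
    using wu wv nonneg pos t(3) by (intro mult_mono) auto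
  moreover have "d * (h + g) < d * (h + g) * (1 + t\<^sup>2)"
    using mult_strict_left_mono[of 1 "1 + t\<^sup>2" "d * (h + g)"] pos t(1) by simp
  moreover have "1 + t\<^sup>2 > 0" by (simp add: add_pos_nonneg)
  ultimately have "width K u' * width K v' < d * (h + g)"
    unfolding uv'(4) by (simp add: divide_less_eq)
  moreover have "(c - e) \<bullet> v = h + g" by (simp add: inner_diff_left coords)
  ultimately show ?thesis using that uv' by metis
qed

section \<open>The rectangle along a diameter\<close>

text \<open>The line through a in direction u separates the two triangles. They overlap only in a
  null set, so their areas, each half of d times a height, add up.\<close>

lemma measure_two_triangles:
  fixes a b c e u v :: "real^2"
  assumes uv: "norm u = 1" "norm v = 1" "u \<bullet> v = 0"
    and ab: "b - a = d *\<^sub>R u" "d \<ge> 0"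
    and c: "(c - a) \<bullet> v \<ge> 0" and e: "(e - a) \<bullet> v \<le> 0"
  shows "measure lebesgue (convex hull {a, b, c} \<union> convex hull {a, b, e}) = d * ((c - e) \<bullet> v) / 2"
proof -
  have in1: "u \<bullet> u = 1" "v \<bullet> v = 1" "v \<bullet> u = 0"
    using uv by (auto simp: dot_square_norm inner_commute)
  have bv: "b \<bullet> v = a \<bullet> v"
    using arg_cong[OF ab(1), of "\<lambda>x. x \<bullet> v"] uv(3) by (simp add: inner_diff_left)
  have m: "measure lebesgue (convex hull {a, b, z}) = d * \<bar>(z - a) \<bullet> v\<bar> / 2" for z
    using measure_triangle[OF uv, of a b z] in1 uv(3) ab by (simp add: abs_mult)
  have "convex hull {a, b, c} \<subseteq> {x. v \<bullet> x \<ge> v \<bullet> a}"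
    using c bv by (intro hull_minimal convex_halfspace_ge) (auto simp: inner_commute[of v] inner_diff_left)
  moreover have "convex hull {a, b, e} \<subseteq> {x. v \<bullet> x \<le> v \<bullet> a}"
    using e bv by (intro hull_minimal convex_halfspace_le) (auto simp: inner_commute[of v] inner_diff_left)
  ultimately have "convex hull {a, b, c} \<inter> convex hull {a, b, e} \<subseteq> {x. v \<bullet> x = v \<bullet> a}"
    by fastforce
  moreover have "negligible {x. v \<bullet> x = v \<bullet> a}"
    using uv by (intro negligible_hyperplane) auto
  ultimately have "measure lebesgue (convex hull {a, b, c} \<inter> convex hull {a, b, e}) = 0"
    using negligible_subset negligible_imp_measure0 by blast
  then have "measure lebesgue (convex hull {a, b, c} \<union> convex hull {a, b, e})
      = measure lebesgue (convex hull {a, b, c}) + measure lebesgue (convex hull {a, b, e})"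
    by (subst measure_Un3) (auto intro!: lmeasurable_compact compact_convex_hull)
  also have "\<dots> = d * ((c - a) \<bullet> v) / 2 + d * (- ((e - a) \<bullet> v)) / 2"
    using c e by (simp add: m)
  also have "\<dots> = d * ((c - e) \<bullet> v) / 2" by (simp add: inner_diff_left field_simps)
  finally show ?thesis .
qed

text \<open>One pair has to serve both bounds. It is the pair along the diameter, except when K is
  the union of the two triangles without being a triangle itself; then it is a rotated pair.\<close>

lemma small_circumscribed_rectangle:
  fixes K :: "(real^2) set"
  assumes K: "convex_body K"
  obtains u v where "norm u = 1" "norm v = 1" "u \<bullet> v = 0"
    "width K u * width K v \<le> 2 * measure lebesgue K"
    "\<not> 2 simplex K \<Longrightarrow> width K u * width K v < 2 * measure lebesgue K"
proof -
  have K': "compact K" "convex K" "K \<noteq> {}" "interior K \<noteq> {}"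
    using K by (auto simp: convex_body_def)
  obtain a b where ab: "a \<in> K" "b \<in> K" "dist a b = diameter K"
    using diameter_compact_attained[OF K'(1,3)] by auto
  define d where "d = diameter K"
  have dist_le: "norm (x - y) \<le> d" if "x \<in> K" "y \<in> K" for x y
    using diameter_bounded_bound[OF compact_imp_bounded[OF K'(1)] that] by (simp add: d_def dist_norm)
  have d: "d > 0"
  proof (rule ccontr)
    assume "\<not> d > 0"
    then have "x = a" if "x \<in> K" for x
      using dist_le[OF that ab(1)] norm_ge_zero[of "x - a"] by (metis eq_iff_diff_eq_0 norm_le_zero_iff not_le order_trans)
    then have "K \<subseteq> {a}" by auto
    then have "interior K \<subseteq> interior {a}" by (rule interior_mono)
    then show False using K'(4) by simp
  qed
  define u where "u = (1 / d) *\<^sub>R (b - a)"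
  have nab: "norm (b - a) = d" using ab(3) by (simp add: d_def dist_norm norm_minus_commute)
  then have nu: "norm u = 1" using d by (simp add: u_def)
  obtain v where v: "norm v = 1" "u \<bullet> v = 0" using exists_orthonormal_partner[OF nu] .
  note uv = nu v
  have bau: "b - a = d *\<^sub>R u" using d by (simp add: u_def)
  have in1: "u \<bullet> u = 1" "v \<bullet> v = 1" "v \<bullet> u = 0"
    using uv by (auto simp: dot_square_norm inner_commute)
  have sq: "((x - y) \<bullet> u)\<^sup>2 + ((x - y) \<bullet> v)\<^sup>2 \<le> d\<^sup>2" if "x \<in> K" "y \<in> K" for x y
    using power_mono[OF dist_le[OF that], of 2] orthonormal_pair_inner[OF uv, of "x - y" "x - y"]
    by (simp add: dot_square_norm power2_eq_square)
  have bu: "b \<bullet> u = a \<bullet> u + d" "b \<bullet> v = a \<bullet> v"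
    using arg_cong[OF bau, of "\<lambda>x. x \<bullet> u"] arg_cong[OF bau, of "\<lambda>x. x \<bullet> v"] in1 uv
    by (simp_all add: inner_diff_left)
  \<comment> \<open>\<open>K\<close> lies in the lens of the points at distance at most \<open>d\<close> from both \<open>a\<close> and \<open>b\<close>.\<close>
  have le_d: "(x - a) \<bullet> u \<le> d" and lt_d: "(x - a) \<bullet> v \<noteq> 0 \<Longrightarrow> (x - a) \<bullet> u < d" if "x \<in> K" for x
  proof -
    have "((x - a) \<bullet> u)\<^sup>2 \<le> d\<^sup>2" using sq[OF that ab(1)] by (smt (verit) zero_le_power2)
    then show "(x - a) \<bullet> u \<le> d" using d by (simp add: abs_le_square_iff[symmetric])
    assume "(x - a) \<bullet> v \<noteq> 0"
    then have "((x - a) \<bullet> u)\<^sup>2 < d\<^sup>2" using sq[OF that ab(1)] by (smt (verit) zero_less_power2)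
    then show "(x - a) \<bullet> u < d" using d power2_less_imp_less[of "(x - a) \<bullet> u" d] by simp
  qed
  \<comment> \<open>The same argument from b. The strict forms, valid off the line ab, will place c
    and e strictly between a and b as the rotation requires.\<close>
  have ge_0: "0 \<le> (x - a) \<bullet> u" and gt_0: "(x - a) \<bullet> v \<noteq> 0 \<Longrightarrow> 0 < (x - a) \<bullet> u" if "x \<in> K" for x
  proof -
    have e: "(b - x) \<bullet> u = d - (x - a) \<bullet> u" "(b - x) \<bullet> v = - ((x - a) \<bullet> v)"
      by (simp_all add: inner_diff_left bu)
    note sq' = sq[OF ab(2) that, unfolded e]
    have "(d - (x - a) \<bullet> u)\<^sup>2 \<le> d\<^sup>2" using sq' by (smt (verit) zero_le_power2)
    then show "0 \<le> (x - a) \<bullet> u" using d by (simp add: abs_le_square_iff[symmetric])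
    assume "(x - a) \<bullet> v \<noteq> 0"
    then have "(- ((x - a) \<bullet> v))\<^sup>2 > 0" by simp
    then have "(d - (x - a) \<bullet> u)\<^sup>2 < d\<^sup>2" using sq' by linarith
    then show "0 < (x - a) \<bullet> u" using d power2_less_imp_less[of "d - (x - a) \<bullet> u" d] by simp
  qed
  have wu: "width K u = d"
  proof (rule antisym)
    show "width K u \<le> d"
      using width_le[OF K'(1,3), of "a \<bullet> u" u "a \<bullet> u + d"] le_d ge_0 by (force simp: inner_diff_left)
    show "d \<le> width K u"
      using width_ge[OF K'(1) ab(2,1), of u] by (simp add: bau in1)
  qed
  obtain c e where ce: "c \<in> K" "e \<in> K" "width K v = (c - e) \<bullet> v"
    "\<And>x. x \<in> K \<Longrightarrow> x \<bullet> v \<le> c \<bullet> v" "\<And>x. x \<in> K \<Longrightarrow> e \<bullet> v \<le> x \<bullet> v"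
    using width_attained[OF K'(1,3), of v] by metis
  have cv: "(c - a) \<bullet> v \<ge> 0" and ev: "(e - a) \<bullet> v \<le> 0"
    using ce(4,5)[OF ab(1)] by (auto simp: inner_diff_left)
  let ?Q = "convex hull {a, b, c} \<union> convex hull {a, b, e}"
  have Q: "?Q \<subseteq> K" "closed ?Q"
    using ab ce K'(2) by (auto intro!: hull_minimal compact_imp_closed compact_convex_hull closed_Un
        simp: subset_hull)
  have mQ: "measure lebesgue ?Q = width K u * width K v / 2"
    using measure_two_triangles[OF uv bau _ cv ev] d wu ce(3) by simp
  have mle: "measure lebesgue ?Q \<le> measure lebesgue K"
    using Q K'(1) by (intro measure_mono_fmeasurable lmeasurable_compact) auto
  show ?thesis
  \<comment> \<open>In the first case the diameter pair suffices: either the area comparison is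
    strict or the strict claim is vacuous.\<close>
  proof (cases "measure lebesgue ?Q < measure lebesgue K \<or> 2 simplex K")
    case True
    then show ?thesis using that[OF uv] mQ mle by force
  next
    case False
    then have QK: "?Q = K" using convex_body_eqI_measure[OF K Q(2,1)] by auto
    \<comment> \<open>If one triangle degenerates, the other has the full height of K across ab and
      hence the whole area of K, so K is that triangle.\<close>
    have flat: "measure lebesgue K \<le> measure lebesgue (convex hull {a, b, z})"
      if "(c - e) \<bullet> v = \<bar>(z - a) \<bullet> v\<bar>" for z
      using that mQ wu ce(3) measure_triangle[OF uv, of a b z] in1 uv bau d QK
      by (simp add: abs_mult)
    have tri: "2 simplex K" if "z = c \<or> z = e" "(c - e) \<bullet> v = \<bar>(z - a) \<bullet> v\<bar>" for z
    proof -
      have "closed (convex hull {a, b, z})"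
        by (intro compact_imp_closed compact_convex_hull) auto
      then have "convex hull {a, b, z} = K"
        using flat[of z] that Q(1) by (intro convex_body_eqI_measure[OF K]) auto
      then show ?thesis using triangle_simplex[OF K] by metis
    qed
    have "(e - a) \<bullet> v \<noteq> 0" using tri[of c] cv False by (auto simp: inner_diff_left)
    moreover have "(c - a) \<bullet> v \<noteq> 0" using tri[of e] ev False by (auto simp: inner_diff_left)
    ultimately obtain u' v' where "norm u' = 1" "norm v' = 1" "u' \<bullet> v' = 0"
      "width K u' * width K v' < d * ((c - e) \<bullet> v)"
      using narrower_rotated_rectangle[OF K'(1,3) _ uv bau, of c e] QK cv ev
        gt_0[OF ce(1)] lt_d[OF ce(1)] gt_0[OF ce(2)] lt_d[OF ce(2)]
      by (metis order_refl order_le_less)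
    moreover have "d * ((c - e) \<bullet> v) = 2 * measure lebesgue K"
      using mQ QK wu ce(3) by simp
    ultimately show ?thesis using that[of u' v'] by simp
  qed
qed

section \<open>From rectangles to the LW-constant\<close>

theorem theorem2:
  fixes K :: "(real^2) set"
  assumes "convex_body K"
  shows "LW_constant K \<ge> 1/2 \<and> (LW_constant K = 1/2 \<longleftrightarrow> 2 simplex K)"
proof -
  have pos: "width K u * width K v > 0" if "norm u = 1" "norm v = 1" for u v
    using that width_pos[OF assms, of u] width_pos[OF assms, of v] by force
  obtain u v where uv: "norm u = 1" "norm v = 1" "u \<bullet> v = 0"
    and eq: "LW_constant K = measure lebesgue K / (width K u * width K v)"
    and max: "\<And>u' v'. norm u' = 1 \<Longrightarrow> norm v' = 1 \<Longrightarrow> u' \<bullet> v' = 0 \<Longrightarrow>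
       measure lebesgue K / (width K u' * width K v') \<le> LW_constant K"
    using LW_constant_attained[OF assms] by metis
  obtain p q where pq: "norm p = 1" "norm q = 1" "p \<bullet> q = 0"
    and le: "width K p * width K q \<le> 2 * measure lebesgue K"
    and less: "\<not> 2 simplex K \<Longrightarrow> width K p * width K q < 2 * measure lebesgue K"
    using small_circumscribed_rectangle[OF assms] by metis
  have "1/2 \<le> measure lebesgue K / (width K p * width K q)"
    using le pos[OF pq(1,2)] by (simp add: le_divide_eq)
  then have ge: "1/2 \<le> LW_constant K" using max[OF pq] by linarith
  moreover have "1/2 < LW_constant K" if "\<not> 2 simplex K"
  proof -
    have "1/2 < measure lebesgue K / (width K p * width K q)"
      using less[OF that] pos[OF pq(1,2)] by (simp add: less_divide_eq)
    then show ?thesis using max[OF pq] by linarith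
  qed
  \<comment> \<open>The frame {u, v} attains the maximum, so the bound for triangles is applied to
    this frame alone.\<close>
  moreover have "LW_constant K \<le> 1/2" if simp: "2 simplex K"
  proof -
    obtain C where C: "card C = 3" "K = convex hull C"
      using simp by (auto simp: simplex_def)
    then obtain a b c where "C = {a, b, c}" by (auto simp: card_3_iff)
    then have "2 * measure lebesgue K \<le> width K u * width K v"
      using triangle_width_product_ge[OF uv, of a b c] C(2) by simp
    then show ?thesis using pos[OF uv(1,2)] by (simp add: eq divide_le_eq)
  qed
  ultimately show ?thesis by force
qed

end
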